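(* For every positive integer $N$, \[ \sum_{\substack{\pi\in\mathcal{P}_e\\ |\pi|=N}} (-1)^{\nu_e(\pi)+1} \;=\; \chi(N \text{ is not a triangular number}). \]
   Context: A partition is a finite non-increasing sequence of positive integers (its parts); $|\pi|$ is the sum of its parts. $\mathcal{P}_e$ is the set of non-empty partitions in which every even part size occurs at most once (odd parts may repeat) and whose smallest part is even. $\nu_e(\pi)$ is the number of even parts of $\pi$. A triangular number is an integer of the form $k(k+1)/2$ with $k\ge 0$ an integer. $\chi(S)$ is $1$ if the statement $S$ is true and $0$ otherwise. *)

theory Defs
  imports Main
begin

definition is_partition :: "nat list \<Rightarrow> bool" where
  "is_partition p \<longleftrightarrow> sorted_wrt (\<ge>) p \<and> (\<forall>x\<in>set p. x > 0)"

definition P_e :: "nat list set" where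
  "P_e = {p. is_partition p \<and> p \<noteq> [] \<and>
             (\<forall>x. even x \<longrightarrow> count_list p x \<le> 1) \<and> even (Min (set p))}"

(* Even parts are counted with multiplicity (on P_e each even size occurs at most once anyway). *)
definition nu_e :: "nat list \<Rightarrow> nat" where
  "nu_e p = length (filter even p)"

definition triangular :: "nat \<Rightarrow> bool" where
  "triangular n \<longleftrightarrow> (\<exists>k. n = k * (k + 1) div 2)"

(* The sum over these index sets is therefore a genuine finite sum. *)
lemma finite_P_e_of_size: "finite {p \<in> P_e. sum_list p = N}"
proof (rule finite_subset)
  have len: "length p \<le> sum_list p" if "\<forall>x\<in>set p. x > 0" for p :: "nat list"
    using that by (induction p) (auto simp: Suc_le_eq)
  show "{p \<in> P_e. sum_list p = N} \<subseteq> {p. set p \<subseteq> {..N} \<and> length p \<le> N}"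
    using len by (auto simp: P_e_def is_partition_def intro: member_le_sum_list)
  show "finite {p. set p \<subseteq> {..N} \<and> length p \<le> N}"
    by (rule finite_lists_length_le) simp
qed

end

(* Let W m = signed_gf m be the generating function, signed by the parity of the number of even
   parts, of the partitions with distinct even parts and all parts at least m.  Removing the smallest
   admissible part gives W m = (1 - q^m) W (m+1) for even m and (1 - q^m) W m = W (m+1) for odd m.
   Hence (1 - q) q^(2n) W (2n+1) = W (2n+2) - W (2n) telescopes, which shows that the sum in
   question plus the N-th coefficient of W 1 is 1.  That W 1 is the generating function of the
   triangular numbers is a theorem of Gauss, obtained from a finite identity in the style of
   D. Shanks: W (2n+1) * (\<Sum>s<2n. q^(s(s+1)/2)) = (\<Sum>s<n. W (2s+1) q^(s(2n+1))). *)
theory Submission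
  imports Defs "HOL-Computational_Algebra.Formal_Power_Series"
begin

unbundle fps_syntax

section \<open>Partitions with bounded smallest part, and removal of that part\<close>

definition parts_ge :: "nat \<Rightarrow> nat \<Rightarrow> nat list set" where
  "parts_ge m N = {p. is_partition p \<and> (\<forall>x. even x \<longrightarrow> count_list p x \<le> 1) \<and>
                      (\<forall>x\<in>set p. m \<le> x) \<and> sum_list p = N}"

text \<open>For m > 0 this is the product of 1 - q^j over even j >= m divided by the product of 1 -
  q^j over odd j >= m. The recurrences below take the place of the infinite products.\<close>

definition signed_gf :: "nat \<Rightarrow> int fps" where
  "signed_gf m = Abs_fps (\<lambda>N. \<Sum>p\<in>parts_ge m N. (- 1) ^ nu_e p)"

lemma is_partition_append_singleton:
  "is_partition (p @ [m]) \<longleftrightarrow> is_partition p \<and> m > 0 \<and> (\<forall>x\<in>set p. m \<le> x)"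
  by (auto simp: is_partition_def sorted_wrt_append)

lemma nu_e_append_singleton: "nu_e (p @ [m]) = nu_e p + of_bool (even m)"
  by (simp add: nu_e_def)

lemma finite_parts_ge: "finite (parts_ge m N)"
proof (rule finite_subset)
  have len: "length p \<le> sum_list p" if "\<forall>x\<in>set p. x > 0" for p :: "nat list"
    using that by (induction p) (auto simp: Suc_le_eq)
  show "parts_ge m N \<subseteq> {p. set p \<subseteq> {..N} \<and> length p \<le> N}"
    using len by (auto simp: parts_ge_def is_partition_def intro: member_le_sum_list)
  show "finite {p. set p \<subseteq> {..N} \<and> length p \<le> N}"
    by (rule finite_lists_length_le) simp
qed

text \<open>Lists are non-increasing, so a smallest part m sits at the end. If m is even it cannot
  recur and the rest starts at m + 1; if m is odd it may recur.\<close>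

lemma append_singleton_in_parts_ge_iff:
  assumes "m > 0"
  shows "p @ [m] \<in> parts_ge m N \<longleftrightarrow>
           m \<le> N \<and> p \<in> parts_ge (if even m then Suc m else m) (N - m)"
proof -
  let ?D = "\<lambda>p. \<forall>x. even x \<longrightarrow> count_list p x \<le> 1"
  have "?D (p @ [m]) \<longleftrightarrow> ?D p \<and> (even m \<longrightarrow> m \<notin> set p)"
  proof -
    have c: "count_list (p @ [m]) x = count_list p x" if "x \<noteq> m" for x
      using that by simp
    have m: "count_list (p @ [m]) m \<le> 1 \<longleftrightarrow> m \<notin> set p"
      using count_list_0_iff[of p m] by simp
    have "count_list p m \<le> 1" if "m \<notin> set p"
      using that by simp
    with m c show ?thesis by metis
  qed
  moreover have "(\<forall>x\<in>set p. m \<le> x) \<and> (even m \<longrightarrow> m \<notin> set p) \<longleftrightarrow>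
      (\<forall>x\<in>set p. (if even m then Suc m else m) \<le> x)"
    by (cases "even m") (auto simp: Suc_le_eq order_le_less)
  moreover have "sum_list (p @ [m]) = N \<longleftrightarrow> m \<le> N \<and> sum_list p = N - m"
    by auto
  moreover have "(\<forall>x\<in>set (p @ [m]). m \<le> x) \<longleftrightarrow> (\<forall>x\<in>set p. m \<le> x)"
    by simp
  ultimately show ?thesis
    using assms unfolding parts_ge_def mem_Collect_eq is_partition_append_singleton by argo
qed

lemma parts_ge_split:
  assumes "m > 0"
  shows "parts_ge m N = parts_ge (Suc m) N \<union>
           (if m \<le> N then (\<lambda>p. p @ [m]) ` parts_ge (if even m then Suc m else m) (N - m) else {})"
    (is "?L = ?R")
proof
  show "?L \<subseteq> ?R"
  proof
    fix p assume p: "p \<in> parts_ge m N"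
    show "p \<in> ?R"
    proof (cases "m \<in> set p")
      case False
      moreover from p have "\<forall>x\<in>set p. m \<le> x" by (simp add: parts_ge_def)
      ultimately have "\<forall>x\<in>set p. Suc m \<le> x" by (metis not_less_eq_eq le_antisym)
      with p show ?thesis by (simp add: parts_ge_def)
    next
      case True
      then obtain p' x where eq: "p = p' @ [x]" by (cases p rule: rev_cases) auto
      with p True have "x = m"
        by (auto simp: parts_ge_def is_partition_append_singleton intro: antisym)
      with p eq show ?thesis
        using append_singleton_in_parts_ge_iff[OF assms, of p' N] by auto
    qed
  qed
  have "parts_ge (Suc m) N \<subseteq> ?L" by (auto simp: parts_ge_def)
  then show "?R \<subseteq> ?L"
    using append_singleton_in_parts_ge_iff[OF assms, of _ N] by auto
qed

lemma signed_gf_rec: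
  assumes "m > 0"
  shows "signed_gf m = signed_gf (Suc m) +
           fps_X ^ m * (if even m then - signed_gf (Suc m) else signed_gf m)"
proof (rule fps_ext)
  fix N
  let ?k = "if even m then Suc m else m"
  let ?A = "if m \<le> N then (\<lambda>p. p @ [m]) ` parts_ge ?k (N - m) else {}"
  have "m \<notin> set p" if "p \<in> parts_ge (Suc m) N" for p
    using that by (fastforce simp: parts_ge_def)
  then have "parts_ge (Suc m) N \<inter> ?A = {}"
    by force
  then have "signed_gf m $ N = signed_gf (Suc m) $ N + (\<Sum>p\<in>?A. (- 1) ^ nu_e p)"
    unfolding signed_gf_def fps_nth_Abs_fps
    by (subst parts_ge_split[OF assms], subst sum.union_disjoint) (auto simp: finite_parts_ge)
  also have "(\<Sum>p\<in>?A. (- 1) ^ nu_e p :: int) =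
      (if m \<le> N then (if even m then - 1 else 1) * signed_gf ?k $ (N - m) else 0)"
    by (simp add: sum.reindex inj_on_def nu_e_append_singleton signed_gf_def sum_negf)
  finally show "signed_gf m $ N = (signed_gf (Suc m) +
      fps_X ^ m * (if even m then - signed_gf (Suc m) else signed_gf m)) $ N"
    by (simp add: fps_X_power_mult_nth)
qed

section \<open>Recurrences and low coefficients of the generating function\<close>

lemma signed_gf_even: "m > 0 \<Longrightarrow> even m \<Longrightarrow> signed_gf m = (1 - fps_X ^ m) * signed_gf (Suc m)"
  using signed_gf_rec[of m] by (simp add: algebra_simps)

lemma signed_gf_odd: "odd m \<Longrightarrow> (1 - fps_X ^ m) * signed_gf m = signed_gf (Suc m)"
  using signed_gf_rec[of m] by (simp add: algebra_simps odd_pos)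

lemma signed_gf_step:
  "(1 - fps_X ^ (2 * n + 1)) * signed_gf (2 * n + 1) =
     (1 - fps_X ^ (2 * n + 2)) * signed_gf (2 * n + 3)"
proof -
  have "Suc (2 * n + 1) = 2 * n + 2" "Suc (2 * n + 2) = 2 * n + 3" by simp_all
  moreover have "odd (2 * n + 1)" "even (2 * n + 2)" "2 * n + 2 > 0" by simp_all
  ultimately show ?thesis
    by (metis signed_gf_odd signed_gf_even)
qed

text \<open>A non-empty partition with all parts at least m has sum at least m, so below degree m
  only the empty partition counts.\<close>

lemma signed_gf_nth_below:
  assumes "N < m"
  shows "signed_gf m $ N = of_bool (N = 0)"
proof -
  have "parts_ge m N = (if N = 0 then {[]} else {})"
  proof -
    have "p = []" if "p \<in> parts_ge m N" for p
      using that assms by (cases p) (auto simp: parts_ge_def)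
    moreover have "[] \<in> parts_ge m N \<longleftrightarrow> N = 0"
      by (auto simp: parts_ge_def is_partition_def)
    ultimately show ?thesis by auto
  qed
  then show ?thesis by (simp add: signed_gf_def nu_e_def)
qed

section \<open>A finite identity and Gauss's theorem on triangular numbers\<close>

lemma shanks_identity:
  "signed_gf (2 * n + 1) * (\<Sum>s<2 * n. fps_X ^ (s * (s + 1) div 2)) =
     (\<Sum>s<n. signed_gf (2 * s + 1) * fps_X ^ (s * (2 * n + 1)))"
proof (induction n)
  case 0
  then show ?case by simp
next
  case (Suc n)
  \<comment> \<open>Passing from n to n + 1 replaces x by q^2 x on the right. On the left, A (Suc n)
    becomes A n at the price of the factor 1 - q x, so the identity is first proved multiplied by
    that factor.\<close>
  define q :: "int fps" where "q = fps_X"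
  define x where "x = q ^ (2 * n + 1)"
  define A where "A = (\<lambda>n. signed_gf (2 * n + 1))"
  define S where "S = (\<lambda>n. \<Sum>s<2 * n. q ^ (s * (s + 1) div 2))"
  \<comment> \<open>B is the telescoping certificate: its differences account for the discrepancy
    between (1 - q x) times a new summand and (1 - x) times the old one. The factor 1 - q^(2s) makes
    B 0 vanish.\<close>
  define B where "B = (\<lambda>s. A s * (1 - q ^ (2 * s)) * x ^ s)"
  have A: "(1 - q ^ (2 * s + 1)) * A s = (1 - q ^ (2 * s + 2)) * A (Suc s)" for s
    using signed_gf_step[of s] by (simp add: A_def q_def eval_nat_numeral)
  have IH: "A n * S n = (\<Sum>s<n. A s * x ^ s)"
    using Suc.IH unfolding A_def S_def q_def x_def
    by (simp only: power_mult[symmetric] mult.commute[of "2 * n + 1"])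
  \<comment> \<open>The two new exponents are the triangular numbers n(2n+1) and (n+1)(2n+1), both
    multiples of the exponent in x.\<close>
  have S: "S (Suc n) = S n + x ^ n * (1 + x)"
  proof -
    have t: "2 * n * (2 * n + 1) div 2 = (2 * n + 1) * n"
      "(2 * n + 1) * (2 * n + 2) div 2 = (2 * n + 1) * (n + 1)"
      by (simp_all add: algebra_simps)
    have "S (Suc n) = S n + q ^ (2 * n * (2 * n + 1) div 2) + q ^ ((2 * n + 1) * (2 * n + 2) div 2)"
      by (simp add: S_def)
    also have "\<dots> = S n + x ^ n * (1 + x)"
      unfolding t x_def by (simp only: power_mult) (simp add: algebra_simps)
    finally show ?thesis .
  qed
  have telescope: "(1 - q * x) * (A s * (q\<^sup>2 * x) ^ s) = (1 - x) * (A s * x ^ s) + (B (Suc s) - B s)" for s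
  proof -
    \<comment> \<open>Trading A (Suc s) for A s makes every term of \<open>telescope\<close> a
      multiple of A s * x^s.\<close>
    have "B (Suc s) = (1 - q ^ (2 * s + 2)) * A (Suc s) * x ^ Suc s"
      by (simp add: B_def mult_ac)
    also have "\<dots> = (1 - q ^ (2 * s + 1)) * A s * x ^ Suc s"
      by (simp only: A)
    finally have B: "B (Suc s) = (1 - q ^ (2 * s + 1)) * A s * x ^ Suc s" .
    show ?thesis
      unfolding B unfolding B_def
      by (simp add: power_mult_distrib power_mult[symmetric] algebra_simps)
  qed
  have "(1 - q * x) * (\<Sum>s<n. A s * (q\<^sup>2 * x) ^ s) = (1 - x) * (\<Sum>s<n. A s * x ^ s) + B n"
    unfolding sum_distrib_left telescope sum.distrib sum_lessThan_telescope by (simp add: B_def)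
  then have R: "(1 - q * x) * (\<Sum>s<Suc n. A s * (q\<^sup>2 * x) ^ s) =
      (1 - x) * (A n * S n) + B n + (1 - q * x) * (A n * (q\<^sup>2 * x) ^ n)"
    by (simp add: IH distrib_left)
  have qx: "q ^ (2 * n + 2) = q * x" by (simp add: x_def)
  have "(1 - q * x) * (A (Suc n) * S (Suc n)) = (1 - x) * A n * S (Suc n)"
    using A[of n] by (simp only: qx x_def[symmetric] mult.assoc[symmetric])
  also have "\<dots> = (1 - x) * (A n * S n) + A n * x ^ n * (1 - x * x)"
    unfolding S by (simp add: algebra_simps)
  \<comment> \<open>This form of x^2 matches B n plus the new summand s = n: the bracket 1 - q^(2n)
    + q^(2n) (1 - q x) collapses to 1 - q^(2n) q x.\<close>
  also have "x * x = q ^ (2 * n) * q * x"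
    by (simp add: x_def mult_ac)
  also have "(1 - x) * (A n * S n) + A n * x ^ n * (1 - q ^ (2 * n) * q * x) =
      (1 - q * x) * (\<Sum>s<Suc n. A s * (q\<^sup>2 * x) ^ s)"
    unfolding R B_def
    by (simp add: power_mult_distrib power_mult[symmetric] algebra_simps)
  finally have eq: "(1 - q * x) * (A (Suc n) * S (Suc n)) =
      (1 - q * x) * (\<Sum>s<Suc n. A s * (q\<^sup>2 * x) ^ s)" .
  have "(1 - q * x) $ 0 \<noteq> 0"
    by (simp add: q_def)
  then have "1 - q * x \<noteq> 0" by force
  with eq have "A (Suc n) * S (Suc n) = (\<Sum>s<Suc n. A s * (q\<^sup>2 * x) ^ s)"
    by simp
  moreover have "(q\<^sup>2 * x) ^ s = q ^ (s * (2 * Suc n + 1))" for s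
  proof -
    have "q\<^sup>2 * x = q ^ (2 * Suc n + 1)"
      by (simp add: x_def power2_eq_square)
    then show ?thesis by (simp only: power_mult[symmetric] mult.commute)
  qed
  ultimately show ?case
    by (simp only: A_def S_def q_def)
qed

lemma strict_mono_triangle: "strict_mono (\<lambda>s. s * (s + 1) div 2 :: nat)"
proof -
  have "Suc n * (Suc n + 1) div 2 = n * (n + 1) div 2 + Suc n" for n :: nat
    by (simp add: algebra_simps)
  then show ?thesis
    unfolding strict_mono_Suc_iff by simp
qed

lemma signed_gf_1_nth: "signed_gf 1 $ N = of_bool (triangular N)"
proof -
  \<comment> \<open>With n = N + 1, all terms with s > 0 on the right of
    \<open>shanks_identity\<close> start beyond degree N, and so do the non-constant terms of
    \<open>signed_gf (2 * n + 1)\<close> on the left.\<close>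
  define n where "n = Suc N"
  let ?t = "\<lambda>s::nat. s * (s + 1) div 2"
  have "signed_gf 1 $ N = (\<Sum>s<n. signed_gf (2 * s + 1) * fps_X ^ (s * (2 * n + 1))) $ N"
  proof -
    have "(signed_gf (2 * s + 1) * fps_X ^ (s * (2 * n + 1))) $ N = 0" if "s > 0" for s
    proof -
      have "1 * (2 * n + 1) \<le> s * (2 * n + 1)"
        using that by (intro mult_right_mono) auto
      then have "N < s * (2 * n + 1)" by (simp add: n_def)
      then show ?thesis by (simp add: fps_X_power_mult_right_nth del: mult_Suc_right)
    qed
    then have "(\<Sum>s<N. (signed_gf (2 * Suc s + 1) * fps_X ^ (Suc s * (2 * n + 1))) $ N) = 0"
      by (intro sum.neutral ballI) blast
    moreover have "(\<Sum>s<n. signed_gf (2 * s + 1) * fps_X ^ (s * (2 * n + 1))) $ N =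
        signed_gf 1 $ N + (\<Sum>s<N. (signed_gf (2 * Suc s + 1) * fps_X ^ (Suc s * (2 * n + 1))) $ N)"
      unfolding fps_sum_nth by (subst n_def, subst sum.lessThan_Suc_shift) simp
    ultimately show ?thesis by simp
  qed
  also have "\<dots> = (signed_gf (2 * n + 1) * (\<Sum>s<2 * n. fps_X ^ ?t s)) $ N"
    by (simp only: shanks_identity)
  also have "\<dots> = (\<Sum>i=0..N. of_bool (i = 0) * (\<Sum>s<2 * n. fps_X ^ ?t s :: int fps) $ (N - i))"
    unfolding fps_mult_nth by (intro sum.cong) (auto simp: signed_gf_nth_below n_def)
  also have "\<dots> = (\<Sum>s<2 * n. of_bool (?t s = N))"
    by (simp add: of_bool_def if_distrib[of "\<lambda>x. x * _"] sum.delta fps_sum_nth fps_X_power_nth eq_commute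
             cong: if_cong)
  also have "\<dots> = of_bool (triangular N)"
  proof (cases "triangular N")
    case True
    then obtain k where k: "N = ?t k" by (auto simp: triangular_def)
    have iff: "?t s = N \<longleftrightarrow> s = k" for s
      unfolding k using strict_mono_eq[OF strict_mono_triangle] by simp
    \<comment> \<open>This puts k inside the summation range s < 2n.\<close>
    have "k \<le> N"
      unfolding k by (cases k) (auto simp: less_eq_div_iff_mult_less_eq)
    then show ?thesis
      unfolding iff using True by (simp add: n_def of_bool_def)
  qed (auto simp: triangular_def)
  finally show ?thesis .
qed

section \<open>The telescoping sum and its application to \<open>P_e\<close>\<close>

lemma signed_gf_telescope:
  "(1 - fps_X) * (signed_gf 1 + (\<Sum>n=1..M. fps_X ^ (2 * n) * signed_gf (2 * n + 1))) =
     signed_gf (2 * M + 2)"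
proof (induction M)
  case 0
  then show ?case
    using signed_gf_odd[of 1] by (simp add: eval_nat_numeral)
next
  case (Suc M)
  let ?n = "Suc M"
  have "(1 - fps_X) * (signed_gf 1 + (\<Sum>n=1..?n. fps_X ^ (2 * n) * signed_gf (2 * n + 1))) =
      signed_gf (2 * ?n) + (1 - fps_X) * (fps_X ^ (2 * ?n) * signed_gf (2 * ?n + 1))"
    using Suc.IH by (simp add: distrib_left add.assoc[symmetric])
  also have "signed_gf (2 * ?n) = (1 - fps_X ^ (2 * ?n)) * signed_gf (2 * ?n + 1)"
    using signed_gf_even[of "2 * ?n"] by simp
  \<comment> \<open>The factors combine as (1 - q^(2n)) + (1 - q) q^(2n) = 1 - q^(2n+1), which the
    odd recurrence absorbs.\<close>
  also have "\<dots> + (1 - fps_X) * (fps_X ^ (2 * ?n) * signed_gf (2 * ?n + 1)) =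
      (1 - fps_X ^ (2 * ?n + 1)) * signed_gf (2 * ?n + 1)"
    by (simp add: algebra_simps)
  also have "\<dots> = signed_gf (2 * ?n + 2)"
    using signed_gf_odd[of "2 * ?n + 1"] by simp
  finally show ?case .
qed

text \<open>Partitions are classified by their smallest part 2n, which occurs exactly once because
  it is even. The condition 2n <= N guards the truncated subtraction.\<close>

lemma P_e_of_size_eq:
  "{p \<in> P_e. sum_list p = N} =
     (\<lambda>(n, p). p @ [2 * n]) ` (SIGMA n:{n\<in>{1..N}. 2 * n \<le> N}. parts_ge (2 * n + 1) (N - 2 * n))"
    (is "?L = ?f ` ?S")
proof -
  have snoc: "p @ [m] \<in> ?L \<longleftrightarrow> even m \<and> m > 0 \<and> p @ [m] \<in> parts_ge m N" for p m
  proof -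
    have "Min (set (p @ [m])) = m" if "\<forall>x\<in>set p. m \<le> x"
      using that by (intro Min_eqI) auto
    then show ?thesis
      unfolding P_e_def parts_ge_def mem_Collect_eq is_partition_append_singleton by auto
  qed
  show ?thesis
  proof (intro equalityI subsetI)
    fix p assume p: "p \<in> ?L"
    then obtain p' m where eq: "p = p' @ [m]"
      by (cases p rule: rev_cases) (auto simp: P_e_def)
    from p[unfolded eq] have m: "even m" "m > 0" "p' @ [m] \<in> parts_ge m N"
      by (simp_all only: snoc)
    then obtain n where n: "m = 2 * n" by auto
    have "(n, p') \<in> ?S"
      using m append_singleton_in_parts_ge_iff[of m p' N] by (auto simp: n)
    then show "p \<in> ?f ` ?S" unfolding eq n by force
  next
    fix p assume "p \<in> ?f ` ?S"
    then obtain n p' where np: "p = p' @ [2 * n]" "n > 0" "2 * n \<le> N"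
      "p' \<in> parts_ge (2 * n + 1) (N - 2 * n)"
      by auto
    then show "p \<in> ?L"
      unfolding np(1) snoc using append_singleton_in_parts_ge_iff[of "2 * n" p' N] by simp
  qed
qed

text \<open>The removed even part contributes one sign, which cancels the + 1 in the
  exponent.\<close>

lemma sum_P_e_eq_nth:
  "(\<Sum>p | p \<in> P_e \<and> sum_list p = N. (- 1 :: int) ^ (nu_e p + 1)) =
     (\<Sum>n=1..N. fps_X ^ (2 * n) * signed_gf (2 * n + 1)) $ N"
proof -
  have "(\<Sum>p | p \<in> P_e \<and> sum_list p = N. (- 1 :: int) ^ (nu_e p + 1)) =
      (\<Sum>n | n \<in> {1..N} \<and> 2 * n \<le> N. signed_gf (2 * n + 1) $ (N - 2 * n))"
    unfolding P_e_of_size_eq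
    by (subst sum.reindex)
       (auto simp: inj_on_def sum.Sigma finite_parts_ge nu_e_append_singleton signed_gf_def
          case_prod_unfold intro!: sum.cong)
  also have "\<dots> = (\<Sum>n=1..N. fps_X ^ (2 * n) * signed_gf (2 * n + 1)) $ N"
    \<comment> \<open>Indices with 2n > N contribute 0, since q^(2n) has no terms of degree N or
      less.\<close>
    unfolding fps_sum_nth fps_X_power_mult_nth
    by (intro sum.mono_neutral_cong_left) auto
  finally show ?thesis .
qed

theorem theorem5p2:
  fixes N :: nat
  assumes "N > 0"
  shows "(\<Sum>p | p \<in> P_e \<and> sum_list p = N. (- 1 :: int) ^ (nu_e p + 1))
           = of_bool (\<not> triangular N)"
proof -
  define G where "G = signed_gf 1 + (\<Sum>n=1..N. fps_X ^ (2 * n) * signed_gf (2 * n + 1))"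
  have G: "(1 - fps_X) * G = signed_gf (2 * N + 2)"
    unfolding G_def by (rule signed_gf_telescope)
  \<comment> \<open>G agrees with 1/(1 - q) up to degree N: the right side of G is 1 up to degree 2N
    + 1, so consecutive coefficients of G are equal.\<close>
  have "G $ k = 1" if "k \<le> N" for k
    using that
  proof (induction k)
    case 0
    have "((1 - fps_X) * G) $ 0 = 1"
      unfolding G by (simp add: signed_gf_nth_below)
    then show ?case by simp
  next
    case (Suc k)
    have "((1 - fps_X) * G) $ Suc k = 0"
      unfolding G using Suc.prems by (simp add: signed_gf_nth_below)
    then show ?case using Suc by (simp add: left_diff_distrib)
  qed
  from this[of N] have
    "of_bool (triangular N) + (\<Sum>n=1..N. fps_X ^ (2 * n) * signed_gf (2 * n + 1)) $ N = 1"
    unfolding G_def fps_add_nth signed_gf_1_nth by simp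
  then show ?thesis
    unfolding sum_P_e_eq_nth by (cases "triangular N") simp_all
qed

end
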